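(* Let $K$ be a field, $S=K[x_1,\ldots,x_n]$, and let $d$ be a positive integer. Let $m_1,\ldots,m_n$ be a sequence of natural numbers and let $\mu=\sum_{i=1}^n m_i$. Suppose that $\binom{n+d-1}{d}-\mu\geq 0$ and that $$\ell=\binom{n+d-1}{d}-\mu=\sum_{j=1}^d\binom{k(j)}{j}$$ is the $d$-th Macaulay representation of $\ell$. Then $m_1,\ldots,m_n$ is a $d$-lex sequence if and only if, for all $i=1,\ldots,n$, $$m_i=\binom{i+d-2}{d-1}-\sum_{j=1}^d\binom{k(j)-n+i-1}{j-1}.$$
   Context: Monomials of the same degree are compared by the lexicographic order with $x_1>x_2>\cdots>x_n$. A lexsegment ideal of $S$ is a monomial ideal which in every degree $e$ is spanned by an initial segment of (that is, by some number, possibly zero, of lexicographically biggest) degree-$e$ monomials of $S$. For a monomial $u\neq1$, $m(u)$ is the largest index $e$ such that $x_e$ divides $u$; for a monomial ideal $L$ with minimal set of monomial generators $G(L)$, $m_i(L)$ is the number of $u\in G(L)$ with $m(u)=i$. A sequence of non-negative integers $m_1,\ldots,m_n$ is called a $d$-lex sequence if there exists a lexsegment ideal $L\subset S$ generated in degree $d$ such that $m_i(L)=m_i$ for all $i$ (the zero ideal is regarded as generated in any degree). The $d$-th Macaulay representation of a natural number $a$ is the unique expression $a=\sum_{j=1}^d\binom{k(j)}{j}$ with $k(d)>k(d-1)>\cdots>k(1)\ge0$. Convention: $\binom pq=0$ whenever $p$ or $q$ is negative, and $\binom00=1$ (as usual $\binom pq=0$ if $0\le p<q$). *)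

theory Defs
  imports Complex_Main "HOL-Library.Poly_Mapping" "HOL-Algebra.Ideal"
begin

text \<open>
  Power products (monomials without coefficient) are exponent vectors \<open>nat \<Rightarrow>\<^sub>0 nat\<close>, written
  additively, so that \<open>0\<close> stands for the monomial \<open>1\<close>; polynomials are finitely supported
  coefficient functions on them, with the convolution product of \<^theory>\<open>HOL-Library.Poly_Mapping\<close>.
  The type has the variables \<open>x\<^sub>i\<close> for all \<open>i :: nat\<close>; the ring \<open>K[x\<^sub>1,\<dots>,x\<^sub>n]\<close> is carved out
  by the support condition below.
\<close>

type_synonym 'k mpoly = "(nat \<Rightarrow>\<^sub>0 nat) \<Rightarrow>\<^sub>0 'k"

definition power_products :: "nat \<Rightarrow> (nat \<Rightarrow>\<^sub>0 nat) set" where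
  "power_products n = {u. Poly_Mapping.keys u \<subseteq> {1..n}}"

definition poly_ring :: "nat \<Rightarrow> 'k::field mpoly ring" where
  "poly_ring n =
    \<lparr>carrier = {p. Poly_Mapping.keys p \<subseteq> power_products n},
     mult = (*), one = 1, zero = 0, add = (+)\<rparr>"

definition monomial_of :: "(nat \<Rightarrow>\<^sub>0 nat) \<Rightarrow> 'k::field mpoly" where
  "monomial_of u = Poly_Mapping.single u 1"

definition scalar_mult :: "'k::field \<Rightarrow> 'k mpoly \<Rightarrow> 'k mpoly" where
  "scalar_mult c p = Poly_Mapping.single 0 c * p"

definition pp_degree :: "(nat \<Rightarrow>\<^sub>0 nat) \<Rightarrow> nat" where
  "pp_degree u = (\<Sum>i\<in>Poly_Mapping.keys u. Poly_Mapping.lookup u i)"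

definition power_products_of_degree :: "nat \<Rightarrow> nat \<Rightarrow> (nat \<Rightarrow>\<^sub>0 nat) set" where
  "power_products_of_degree n e = {u \<in> power_products n. pp_degree u = e}"

definition homogeneous_component :: "nat \<Rightarrow> 'k::field mpoly set \<Rightarrow> 'k mpoly set" where
  "homogeneous_component e L = {p \<in> L. \<forall>u\<in>Poly_Mapping.keys p. pp_degree u = e}"

definition monomial_ideal :: "nat \<Rightarrow> 'k::field mpoly set \<Rightarrow> bool" where
  "monomial_ideal n L \<longleftrightarrow>
    (\<exists>M\<subseteq>power_products n. L = Idl\<^bsub>poly_ring n\<^esub> (monomial_of ` M))"

text \<open>
  The library's linear order on \<open>nat \<Rightarrow>\<^sub>0 nat\<close> compares exponents at the smallest index where they
  differ. On power products of equal degree this is the lexicographic order with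
  \<open>x\<^sub>1 > x\<^sub>2 > \<dots> > x\<^sub>n\<close>.
\<close>

lemma power_product_less_iff:
  fixes u v :: "nat \<Rightarrow>\<^sub>0 nat"
  shows "u < v \<longleftrightarrow>
    (\<exists>i. Poly_Mapping.lookup u i < Poly_Mapping.lookup v i \<and>
         (\<forall>j<i. Poly_Mapping.lookup u j = Poly_Mapping.lookup v j))"
  by (simp add: less_poly_mapping.rep_eq less_fun_def)

definition lex_initial_segment :: "nat \<Rightarrow> nat \<Rightarrow> (nat \<Rightarrow>\<^sub>0 nat) set \<Rightarrow> bool" where
  "lex_initial_segment n e T \<longleftrightarrow>
    T \<subseteq> power_products_of_degree n e \<and>
    (\<forall>u\<in>T. \<forall>v\<in>power_products_of_degree n e. u < v \<longrightarrow> v \<in> T)"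

definition lexsegment_ideal :: "nat \<Rightarrow> 'k::field mpoly set \<Rightarrow> bool" where
  "lexsegment_ideal n L \<longleftrightarrow>
    monomial_ideal n L \<and>
    (\<forall>e. \<exists>T. lex_initial_segment n e T \<and>
      homogeneous_component e L = module.span scalar_mult (monomial_of ` T))"

definition generated_in_degree :: "nat \<Rightarrow> nat \<Rightarrow> 'k::field mpoly set \<Rightarrow> bool" where
  "generated_in_degree n d L \<longleftrightarrow> L = Idl\<^bsub>poly_ring n\<^esub> (homogeneous_component d L)"

text \<open>
  \<open>G(L)\<close>, as a set of power products: the inclusion-minimal set of monomials generating \<open>L\<close>
  (which is unique for a monomial ideal \<open>L\<close>).
\<close>

definition minimal_monomial_generators :: "nat \<Rightarrow> 'k::field mpoly set \<Rightarrow> (nat \<Rightarrow>\<^sub>0 nat) set" where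
  "minimal_monomial_generators n L =
    (THE G. G \<subseteq> power_products n \<and> L = Idl\<^bsub>poly_ring n\<^esub> (monomial_of ` G) \<and>
      (\<forall>H. H \<subset> G \<longrightarrow> L \<noteq> Idl\<^bsub>poly_ring n\<^esub> (monomial_of ` H)))"

definition max_index :: "(nat \<Rightarrow>\<^sub>0 nat) \<Rightarrow> nat" where
  "max_index u = Max (Poly_Mapping.keys u)"

text \<open>The guard \<open>u \<noteq> 0\<close> excludes the monomial \<open>1\<close>, for which \<open>max_index\<close> is meaningless.\<close>

definition generator_count :: "nat \<Rightarrow> 'k::field mpoly set \<Rightarrow> nat \<Rightarrow> nat" where
  "generator_count n L i =
    card {u \<in> minimal_monomial_generators n L. u \<noteq> 0 \<and> max_index u = i}"

text \<open>Only the values \<open>m 1, \<dots>, m n\<close> matter; the first argument fixes the coefficient field.\<close>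

definition d_lex_sequence :: "'k::field itself \<Rightarrow> nat \<Rightarrow> nat \<Rightarrow> (nat \<Rightarrow> nat) \<Rightarrow> bool" where
  "d_lex_sequence K n d m \<longleftrightarrow>
    (\<exists>L :: 'k mpoly set. lexsegment_ideal n L \<and> generated_in_degree n d L \<and>
      (\<forall>i\<in>{1..n}. generator_count n L i = m i))"

text \<open>Binomial coefficients of integers, zero as soon as one of the entries is negative.\<close>

definition int_binomial :: "int \<Rightarrow> int \<Rightarrow> int" where
  "int_binomial p q = (if p < 0 \<or> q < 0 then 0 else int (nat p choose nat q))"

definition macaulay_representation :: "nat \<Rightarrow> nat \<Rightarrow> (nat \<Rightarrow> nat) \<Rightarrow> bool" where
  "macaulay_representation d a k \<longleftrightarrow>
    strict_mono_on {1..d} k \<and> a = (\<Sum>j=1..d. k j choose j)"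

text \<open>The constructions above rest on the expected structures.\<close>

lemma cring_poly_ring: "cring (poly_ring n :: 'k::field mpoly ring)"
proof -
  have mult: "Poly_Mapping.keys (p * q) \<subseteq> power_products n"
    if "Poly_Mapping.keys p \<subseteq> power_products n" "Poly_Mapping.keys q \<subseteq> power_products n"
    for p q :: "'k mpoly"
  proof
    fix w assume "w \<in> Poly_Mapping.keys (p * q)"
    then obtain u v where "w = u + v" "u \<in> Poly_Mapping.keys p" "v \<in> Poly_Mapping.keys q"
      using keys_mult[of p q] by blast
    with that show "w \<in> power_products n"
      unfolding power_products_def using keys_add[of u v] by blast
  qed
  have add: "Poly_Mapping.keys (p + q) \<subseteq> power_products n"
    if "Poly_Mapping.keys p \<subseteq> power_products n" "Poly_Mapping.keys q \<subseteq> power_products n"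
    for p q :: "'k mpoly"
    using that keys_add[of p q] by blast
  have neg: "\<exists>q. Poly_Mapping.keys q \<subseteq> power_products n \<and> p + q = 0"
    if "Poly_Mapping.keys p \<subseteq> power_products n" for p :: "'k mpoly"
    using that by (intro exI[of _ "- p"]) simp
  have zero: "0 \<in> power_products n"
    by (simp add: power_products_def)
  have "abelian_group (poly_ring n :: 'k mpoly ring)"
    by (rule abelian_groupI) (simp_all add: poly_ring_def add neg algebra_simps)
  moreover have "Group.comm_monoid (poly_ring n :: 'k mpoly ring)"
    by (rule comm_monoidI) (simp_all add: poly_ring_def mult zero algebra_simps)
  ultimately show ?thesis
    by (rule cringI) (simp add: poly_ring_def algebra_simps)
qed

lemma vector_space_scalar_mult: "vector_space (scalar_mult :: 'k::field \<Rightarrow> _)"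
  by unfold_locales
     (simp_all add: scalar_mult_def algebra_simps single_add mult_single flip: mult.assoc)

end

theory Submission
  imports Defs
begin

text \<open>
  A lexsegment ideal \<open>L\<close> generated in degree \<open>d\<close> is the same thing as a lexsegment \<open>T\<close> of degree-\<open>d\<close>
  monomials: \<open>T\<close> spans \<open>L\<^sub>d\<close>, it is the minimal generating set \<open>G(L)\<close>, and conversely the ideal generated by
  any such \<open>T\<close> is a lexsegment ideal, because multiplying a lexsegment by all variables gives a lexsegment again
  (\<open>lex_initial_segment_multiples\<close>). Hence \<open>m\<^sub>1, \<dots>, m\<^sub>n\<close> is a \<open>d\<close>-lex sequence iff
  \<open>m\<^sub>i = |{u \<in> T. m(u) = i}|\<close> for some \<open>T\<close> (\<open>d_lex_sequence_iff\<close>). As \<open>T\<close> is determined by its size, which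
  must be \<open>\<mu>\<close>, it remains to count the monomials of this one lexsegment by their largest variable.

  It is easier to count the \<open>\<ell>\<close> smallest monomials, which \<open>T\<close> omits. Put \<open>c(j) = n + j - 1 - k(j)\<close>. Then
  \<open>c(d) \<le> \<dots> \<le> c(1)\<close>, and the sum of the \<open>k(j) choose j\<close> is the number of monomials below
  \<open>x\<^bsub>c(d)\<^esub> \<cdots> x\<^bsub>c(1)\<^esub>\<close>: such a monomial either lies in the variables after \<open>x\<^bsub>c(d)\<^esub>\<close>, of which there are
  \<open>k(d) - d + 1\<close>, or is \<open>x\<^bsub>c(d)\<^esub>\<close> times a monomial of degree \<open>d - 1\<close> below \<open>x\<^bsub>c(d-1)\<^esub> \<cdots> x\<^bsub>c(1)\<^esub>\<close>
  (\<open>card_monomials_below\<close>). So the omitted monomials are exactly these (\<open>lex_complement_eq_below\<close>). The same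
  recursion with \<open>i\<close> in place of \<open>n\<close> counts those in \<open>x\<^sub>1, \<dots>, x\<^sub>i\<close>. Subtracted from the number of all
  monomials in \<open>x\<^sub>1, \<dots>, x\<^sub>i\<close>, this counts the members of \<open>T\<close> in \<open>x\<^sub>1, \<dots>, x\<^sub>i\<close>, and the difference for \<open>i\<close>
  and \<open>i - 1\<close> is the claimed formula (\<open>card_max_index_lex_segment\<close>).
\<close>

section \<open>Power products and their degree\<close>

text \<open>The variable \<open>x\<^sub>i\<close>, as a power product.\<close>

abbreviation var :: "nat \<Rightarrow> (nat \<Rightarrow>\<^sub>0 nat)" where
  "var i \<equiv> Poly_Mapping.single i (Suc 0)"

text \<open>The power products of degree \<open>d\<close> in the variables \<open>x\<^sub>i\<close> with \<open>i \<in> A\<close>.\<close>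

definition monomials_in :: "nat set \<Rightarrow> nat \<Rightarrow> (nat \<Rightarrow>\<^sub>0 nat) set" where
  "monomials_in A d = {u. Poly_Mapping.keys u \<subseteq> A \<and> pp_degree u = d}"

lemma power_products_of_degree_eq: "power_products_of_degree n d = monomials_in {1..n} d"
  by (simp add: power_products_of_degree_def monomials_in_def power_products_def)

lemma keys_add_nat:
  fixes u v :: "nat \<Rightarrow>\<^sub>0 nat"
  shows "Poly_Mapping.keys (u + v) = Poly_Mapping.keys u \<union> Poly_Mapping.keys v"
  by (auto simp: in_keys_iff lookup_add)

lemma pp_degree_superset:
  "finite A \<Longrightarrow> Poly_Mapping.keys u \<subseteq> A \<Longrightarrow> pp_degree u = (\<Sum>i\<in>A. Poly_Mapping.lookup u i)"
  unfolding pp_degree_def by (rule sum.mono_neutral_left) (auto simp: in_keys_iff)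

lemma pp_degree_add: "pp_degree (u + v) = pp_degree u + pp_degree v"
proof -
  have "pp_degree w = (\<Sum>i\<in>Poly_Mapping.keys u \<union> Poly_Mapping.keys v. Poly_Mapping.lookup w i)"
    if "Poly_Mapping.keys w \<subseteq> Poly_Mapping.keys u \<union> Poly_Mapping.keys v" for w
    using that by (intro pp_degree_superset) auto
  then show ?thesis
    by (simp add: keys_add_nat lookup_add sum.distrib)
qed

lemma pp_degree_var: "pp_degree (var i) = Suc 0"
  by (simp add: pp_degree_def)

lemma pp_degree_zero_iff: "pp_degree u = 0 \<longleftrightarrow> u = 0"
proof
  assume "pp_degree u = 0"
  then have "\<forall>i\<in>Poly_Mapping.keys u. Poly_Mapping.lookup u i = 0"
    by (simp add: pp_degree_def)
  then show "u = 0"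
    by (intro poly_mapping_eqI) (auto simp: in_keys_iff)
qed (simp add: pp_degree_def)

lemma var_factor:
  assumes "a \<in> Poly_Mapping.keys u"
  obtains u' where "u = var a + u'"
proof
  show "u = var a + (u - var a)"
    using assms by (intro poly_mapping_eqI) (auto simp: lookup_add lookup_minus lookup_single in_keys_iff when_def)
qed

lemma monomials_in_0: "monomials_in A 0 = {0}"
  by (auto simp: monomials_in_def pp_degree_zero_iff)

lemma monomials_in_empty: "monomials_in {} (Suc d) = {}"
  by (auto simp: monomials_in_def pp_degree_def)

lemma monomials_in_insert:
  assumes "a \<notin> A"
  shows "monomials_in (insert a A) (Suc d)
    = monomials_in A (Suc d) \<union> (+) (var a) ` monomials_in (insert a A) d" (is "?L = ?R")
proof
  show "?R \<subseteq> ?L"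
    by (auto simp: monomials_in_def keys_add_nat pp_degree_add pp_degree_var)
  show "?L \<subseteq> ?R"
  proof
    fix u assume u: "u \<in> ?L"
    show "u \<in> ?R"
    proof (cases "a \<in> Poly_Mapping.keys u")
      case True
      then obtain u' where u': "u = var a + u'" by (rule var_factor)
      with u have "u' \<in> monomials_in (insert a A) d"
        by (auto simp: monomials_in_def keys_add_nat pp_degree_add pp_degree_var)
      with u' show ?thesis by blast
    qed (use u in \<open>auto simp: monomials_in_def\<close>)
  qed
qed

lemma finite_monomials_in:
  assumes "finite A"
  shows "finite (monomials_in A d)"
  using assms
proof (induction A arbitrary: d)
  case empty
  show ?case by (cases d) (simp_all add: monomials_in_0 monomials_in_empty)
next
  case (insert a A)
  show ?case
    by (induction d) (simp_all add: monomials_in_0 monomials_in_insert insert)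
qed

lemma card_monomials_in:
  assumes "finite A"
  shows "card (monomials_in A d) = (card A + d - 1) choose d"
  using assms
proof (induction A arbitrary: d)
  case empty
  show ?case by (cases d) (simp_all add: monomials_in_0 monomials_in_empty)
next
  case (insert a A)
  show ?case
  proof (induction d)
    case 0
    show ?case by (simp add: monomials_in_0)
  next
    case (Suc d)
    have "monomials_in A (Suc d) \<inter> (+) (var a) ` monomials_in (insert a A) d = {}"
      using \<open>a \<notin> A\<close> by (auto simp: monomials_in_def keys_add_nat)
    then have "card (monomials_in (insert a A) (Suc d))
        = card (monomials_in A (Suc d)) + card (monomials_in (insert a A) d)"
      using insert.hyps by (simp add: monomials_in_insert card_Un_disjoint finite_monomials_in card_image)
    then show ?case
      using insert.hyps by (simp add: insert.IH Suc.IH)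
  qed
qed

section \<open>Counting the power products below a given one\<close>

lemma lookup_sum_var:
  "finite J \<Longrightarrow> Poly_Mapping.lookup (\<Sum>j\<in>J. var (c j)) i = card {j\<in>J. c j = i}"
  by (simp add: lookup_sum lookup_single when_def sum.If_cases Int_def)

text \<open>
  If \<open>w\<close> involves no variable before \<open>x\<^sub>c\<close>, then a monomial below \<open>x\<^sub>c \<cdot> w\<close> involves none either; it is
  either a monomial in the variables after \<open>x\<^sub>c\<close>, or \<open>x\<^sub>c\<close> times a monomial below \<open>w\<close>. The exponents at
  the index 0 take part in the order, so that \<open>x\<^sub>0\<close> counts as a variable here.
\<close>

lemma monomials_below_step:
  assumes w: "Poly_Mapping.keys w \<subseteq> {c..}"
  shows "{u \<in> monomials_in {..i} (Suc d). u < var c + w} =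
    monomials_in {c<..i} (Suc d) \<union>
    (if c \<le> i then (+) (var c) ` {u \<in> monomials_in {..i} d. u < w} else {})" (is "?L = ?R")
proof
  have w0: "Poly_Mapping.lookup w j = 0" if "j < c" for j
    using w that by (auto simp: in_keys_iff subset_iff)
  show "?R \<subseteq> ?L"
  proof
    fix u assume "u \<in> ?R"
    then consider "u \<in> monomials_in {c<..i} (Suc d)"
      | u' where "c \<le> i" "u = var c + u'" "u' \<in> monomials_in {..i} d" "u' < w"
      by (auto split: if_splits)
    then show "u \<in> ?L"
    proof cases
      case 1
      then have "Poly_Mapping.lookup u j = 0" if "j \<le> c" for j
        using that by (auto simp: monomials_in_def in_keys_iff subset_iff)
      then have "u < var c + w"
        unfolding power_product_less_iff
        by (intro exI[of _ c]) (auto simp: lookup_add lookup_single w0)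
      with 1 show ?thesis by (auto simp: monomials_in_def)
    next
      case 2
      then show ?thesis by (auto simp: monomials_in_def keys_add_nat pp_degree_add pp_degree_var)
    qed
  qed
  show "?L \<subseteq> ?R"
  proof
    fix u assume "u \<in> ?L"
    then have u: "u \<in> monomials_in {..i} (Suc d)" and "u < var c + w" by auto
    then obtain a where a: "Poly_Mapping.lookup u a < Poly_Mapping.lookup (var c + w) a"
      "\<forall>j<a. Poly_Mapping.lookup u j = Poly_Mapping.lookup (var c + w) j"
      by (auto simp: power_product_less_iff)
    have "c \<le> a"
      using a(1) w0[of a] by (cases "c \<le> a") (auto simp: lookup_add lookup_single)
    then have u0: "Poly_Mapping.lookup u j = 0" if "j < c" for j
      using a(2) w0[of j] that by (auto simp: lookup_add lookup_single)
    show "u \<in> ?R"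
    proof (cases "c \<in> Poly_Mapping.keys u")
      case True
      then obtain u' where u': "u = var c + u'" by (rule var_factor)
      have "c \<le> i" using True u by (auto simp: monomials_in_def)
      moreover have "u' < w" using \<open>u < var c + w\<close> u' by simp
      moreover have "u' \<in> monomials_in {..i} d"
        using u u' by (auto simp: monomials_in_def keys_add_nat pp_degree_add pp_degree_var)
      ultimately show ?thesis using u' by auto
    next
      case False
      have "Poly_Mapping.keys u \<subseteq> {c<..i}"
      proof
        fix j assume "j \<in> Poly_Mapping.keys u"
        then show "j \<in> {c<..i}"
          using u u0[of j] False by (cases j c rule: linorder_cases) (auto simp: monomials_in_def in_keys_iff subset_iff)
      qed
      with u show ?thesis by (simp add: monomials_in_def)
    qed
  qed
qed

text \<open>
  The monomials below \<open>x\<^bsub>c(1)\<^esub> \<cdots> x\<^bsub>c(d)\<^esub>\<close> split into \<open>d\<close> blocks: the block of \<open>j\<close> consists of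
  \<open>x\<^bsub>c(d)\<^esub> \<cdots> x\<^bsub>c(j+1)\<^esub>\<close> times the monomials of degree \<open>j\<close> in \<open>x\<^bsub>c(j)+1\<^esub>, \<dots>, x\<^sub>i\<close>. For \<open>i \<le> c(j)\<close>
  the block is empty, in accordance with the binomial coefficient, whatever the truncated
  subtraction yields.
\<close>

lemma card_monomials_below:
  assumes "antimono_on {1..d} c"
  shows "card {u \<in> monomials_in {..i} d. u < (\<Sum>j=1..d. var (c j))} =
    (\<Sum>j=1..d. (i + j - 1 - c j) choose j)"
  using assms
proof (induction d)
  case 0
  show ?case by (simp add: monomials_in_0)
next
  case (Suc d)
  define w where "w = (\<Sum>j=1..d. var (c j))"
  let ?c = "c (Suc d)"
  have c: "?c \<le> c j" if "j \<in> {1..d}" for j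
    using Suc.prems that by (auto simp: monotone_on_def)
  have w: "Poly_Mapping.keys w \<subseteq> {?c..}"
  proof
    fix a assume "a \<in> Poly_Mapping.keys w"
    then have "card {j\<in>{1..d}. c j = a} \<noteq> 0"
      by (simp add: w_def in_keys_iff lookup_sum_var del: card_eq_0_iff)
    then have "{j\<in>{1..d}. c j = a} \<noteq> {}" by (metis card.empty)
    then show "a \<in> {?c..}" using c by auto
  qed
  have sum: "(\<Sum>j=1..Suc d. var (c j)) = var ?c + w"
    by (simp add: w_def add.commute)
  have IH: "card {u \<in> monomials_in {..i} d. u < w} = (\<Sum>j=1..d. (i + j - 1 - c j) choose j)"
    unfolding w_def using Suc.prems by (intro Suc.IH) (auto simp: monotone_on_def)
  show ?case
  proof (cases "?c \<le> i")
    case True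
    have "monomials_in {?c<..i} (Suc d) \<inter> (+) (var ?c) ` {u \<in> monomials_in {..i} d. u < w} = {}"
      by (auto simp: monomials_in_def keys_add_nat)
    then have "card {u \<in> monomials_in {..i} (Suc d). u < var ?c + w} =
        card (monomials_in {?c<..i} (Suc d)) + card {u \<in> monomials_in {..i} d. u < w}"
      using True by (simp add: monomials_below_step[OF w] card_Un_disjoint finite_monomials_in card_image)
    then show ?thesis
      unfolding sum using True by (simp add: IH card_monomials_in)
  next
    case False
    have "(\<Sum>j=1..Suc d. (i + j - 1 - c j) choose j) = 0"
    proof (rule sum.neutral, rule ballI)
      fix j assume j: "j \<in> {1..Suc d}"
      have "i < c j" using c[of j] False j by (cases "j = Suc d") auto
      with j show "(i + j - 1 - c j) choose j = 0" by (intro binomial_eq_0) auto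
    qed
    moreover have "{u \<in> monomials_in {..i} (Suc d). u < var ?c + w} = {}"
      using False by (simp add: monomials_below_step[OF w] monomials_in_empty)
    ultimately show ?thesis unfolding sum by (simp only: card.empty)
  qed
qed

section \<open>Lexsegments and Macaulay representations\<close>

text \<open>In a linear order, a downward closed subset of a finite set is determined by its size.\<close>

lemma lower_subset_eq_of_card:
  fixes S :: "'a::linorder set"
  assumes "finite S" "A \<subseteq> S" "B \<subseteq> S" "card A = card B"
    and A: "\<And>u v. u \<in> A \<Longrightarrow> v \<in> S \<Longrightarrow> v < u \<Longrightarrow> v \<in> A"
    and B: "\<And>u v. u \<in> B \<Longrightarrow> v \<in> S \<Longrightarrow> v < u \<Longrightarrow> v \<in> B"
  shows "A = B"
proof -
  have "finite A" "finite B" using assms finite_subset by blast+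
  have "A \<subseteq> B \<or> B \<subseteq> A"
  proof (rule ccontr)
    assume "\<not> ?thesis"
    then obtain a b where "a \<in> A" "a \<notin> B" "b \<in> B" "b \<notin> A" by auto
    then show False
      using A[of a b] B[of b a] assms(2,3) by (cases a b rule: linorder_cases) auto
  qed
  then show ?thesis
    using \<open>finite A\<close> \<open>finite B\<close> \<open>card A = card B\<close> card_subset_eq by metis
qed

lemma ex_upper_subset_card:
  fixes S :: "'a::linorder set"
  assumes "finite S" "m \<le> card S"
  obtains T where "T \<subseteq> S" "card T = m" "\<And>u v. u \<in> T \<Longrightarrow> v \<in> S \<Longrightarrow> u < v \<Longrightarrow> v \<in> T"
proof -
  from assms(2)
  have "\<exists>T\<subseteq>S. card T = m \<and> (\<forall>u\<in>T. \<forall>v\<in>S. u < v \<longrightarrow> v \<in> T)"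
  proof (induction m)
    case 0
    show ?case by (intro exI[of _ "{}"]) simp
  next
    case (Suc m)
    then obtain T where T: "T \<subseteq> S" "card T = m" "\<forall>u\<in>T. \<forall>v\<in>S. u < v \<longrightarrow> v \<in> T" by auto
    have fin: "finite (S - T)" "finite T" using \<open>finite S\<close> T(1) finite_subset by auto
    have "S - T \<noteq> {}" using Suc.prems T card_mono[OF fin(2), of S] by auto
    then have M: "Max (S - T) \<in> S - T" "\<And>v. v \<in> S - T \<Longrightarrow> v \<le> Max (S - T)"
      using Max_in[of "S - T"] Max_ge[of "S - T"] fin by blast+
    show ?case
    proof (intro exI[of _ "insert (Max (S - T)) T"] conjI ballI impI)
      fix u v assume "u \<in> insert (Max (S - T)) T" "v \<in> S" "u < v"
      then show "v \<in> insert (Max (S - T)) T"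
        using T(3) M(2)[of v] by (cases "v \<in> T") auto
    qed (use T M fin in auto)
  qed
  then show ?thesis using that by blast
qed

lemma lex_initial_segment_subset: "lex_initial_segment n d T \<Longrightarrow> T \<subseteq> monomials_in {1..n} d"
  by (simp add: lex_initial_segment_def power_products_of_degree_eq)

text \<open>
  If \<open>k\<close> gives the Macaulay representation of the number of monomials that an initial segment \<open>T\<close>
  omits, these are the monomials below \<open>\<Prod>\<^sub>j x\<^bsub>c(j)\<^esub>\<close> with \<open>c(j) = n + j - 1 - k(j)\<close>: there are as many
  of either kind. The value \<open>c(d) = 0\<close> occurs, namely for \<open>T = {}\<close>; therefore the comparison takes
  place among the monomials in \<open>x\<^sub>0, \<dots>, x\<^sub>n\<close>.
\<close>

lemma lex_complement_eq_below:
  assumes "d > 0" and T: "lex_initial_segment n d T"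
    and l: "card (monomials_in {1..n} d - T) = l"
    and k: "macaulay_representation d l k"
  defines "c \<equiv> \<lambda>j. n + j - 1 - k j"
  shows "monomials_in {1..n} d - T = {u \<in> monomials_in {..n} d. u < (\<Sum>j=1..d. var (c j))}"
    and "antimono_on {1..d} c" and "\<And>j. j \<in> {1..d} \<Longrightarrow> k j \<le> n + j - 1"
proof -
  have mono: "k i < k j" if "i \<in> {1..d}" "j \<in> {1..d}" "i < j" for i j
    using k that by (auto simp: macaulay_representation_def strict_mono_on_def)
  have l_sum: "l = (\<Sum>j=1..d. k j choose j)"
    using k by (simp add: macaulay_representation_def)
  have k_top: "k d \<le> n + d - 1"
  proof (rule ccontr)
    assume "\<not> ?thesis"
    then have "(n + d) choose d \<le> k d choose d"
      by (intro binomial_right_mono) auto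
    also have "\<dots> \<le> l"
      \<comment> \<open>the binomial coefficient is the term of index \<open>d\<close> of the representation\<close>
      unfolding l_sum using \<open>d > 0\<close> by (intro member_le_sum) auto
    also have "l \<le> card (monomials_in {1..n} d)"
      unfolding l[symmetric] by (intro card_mono finite_monomials_in) auto
    also have "\<dots> = (n + d - 1) choose d"
      by (simp add: card_monomials_in)
    also have "\<dots> < (n + d) choose d"
      using \<open>d > 0\<close> by (cases d) auto
    finally show False by simp
  qed
  have gap: "k i + (j - i) \<le> k j" if "1 \<le> i" "i \<le> j" "j \<le> d" for i j
    using that(2,3)
  proof (induction j rule: dec_induct)
    case (step j)
    then show ?case using mono[of j "Suc j"] \<open>1 \<le> i\<close> by simp
  qed simp
  show le: "k j \<le> n + j - 1" if "j \<in> {1..d}" for j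
  proof -
    from that have "1 \<le> j" "j \<le> d" by auto
    moreover from this have "k j + (d - j) \<le> k d" by (intro gap) auto
    ultimately show ?thesis using k_top by linarith
  qed
  show anti: "antimono_on {1..d} c"
  proof (rule monotone_onI)
    fix i j assume "i \<in> {1..d}" "j \<in> {1..d}" "i \<le> j"
    then show "c j \<le> c i" using gap[of i j] le[of i] le[of j] by (auto simp: c_def)
  qed
  let ?S = "monomials_in {..n} d"
  let ?B = "{u \<in> ?S. u < (\<Sum>j=1..d. var (c j))}"
  show "monomials_in {1..n} d - T = ?B"
  proof (rule lower_subset_eq_of_card[of ?S])
    have "card ?B = (\<Sum>j=1..d. (n + j - 1 - c j) choose j)"
      using anti by (rule card_monomials_below)
    also have "\<dots> = l"
      unfolding l_sum c_def by (intro sum.cong refl) (simp only: diff_diff_cancel[OF le])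
    finally show "card (monomials_in {1..n} d - T) = card ?B" using l by simp
  next
    fix u v assume u: "u \<in> monomials_in {1..n} d - T" and v: "v \<in> ?S" "v < u"
    \<comment> \<open>going down in the order cannot introduce the variable \<open>x\<^sub>0\<close>\<close>
    have "Poly_Mapping.lookup u 0 = 0"
      using u by (auto simp: monomials_in_def in_keys_iff)
    moreover have "Poly_Mapping.lookup v 0 \<le> Poly_Mapping.lookup u 0"
      using \<open>v < u\<close> unfolding power_product_less_iff by (metis gr0I le_eq_less_or_eq)
    ultimately have "0 \<notin> Poly_Mapping.keys v" by (simp add: in_keys_iff)
    then have "Poly_Mapping.keys v \<subseteq> {1..n}"
      using v by (auto simp: monomials_in_def subset_iff Suc_le_eq intro: gr0I)
    then have "v \<in> monomials_in {1..n} d"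
      using v by (simp add: monomials_in_def)
    then show "v \<in> monomials_in {1..n} d - T"
      using T u v by (auto simp: lex_initial_segment_def power_products_of_degree_eq)
  qed (use finite_monomials_in[of "{..n}" d] in \<open>auto simp: monomials_in_def\<close>)
qed

lemma max_index_eq_iff:
  assumes "u \<noteq> 0" "i > 0"
  shows "max_index u = i \<longleftrightarrow> Poly_Mapping.keys u \<subseteq> {..i} \<and> \<not> Poly_Mapping.keys u \<subseteq> {..i - 1}"
proof -
  have ne: "Poly_Mapping.keys u \<noteq> {}"
    using assms(1) by (metis poly_mapping_eqI lookup_zero not_in_keys_iff_lookup_eq_zero empty_iff)
  have "Poly_Mapping.keys u \<subseteq> {..b} \<longleftrightarrow> max_index u \<le> b" for b
    using ne by (auto simp: max_index_def)
  then show ?thesis using assms(2) by auto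
qed

text \<open>
  The monomials with \<open>m(u) = i\<close> are those in \<open>x\<^sub>1, \<dots>, x\<^sub>i\<close> but not in \<open>x\<^sub>1, \<dots>, x\<^bsub>i-1\<^esub>\<close>; so the formula is a
  difference of two instances of the count of monomials below a given one, evaluated termwise by
  Pascal's rule.
\<close>

lemma card_max_index_lex_segment:
  assumes "d > 0" and T: "lex_initial_segment n d T"
    and l: "card (monomials_in {1..n} d - T) = l"
    and k: "macaulay_representation d l k"
    and i: "i \<in> {1..n}"
  shows "int (card {u \<in> T. max_index u = i}) = int_binomial (int i + int d - 2) (int d - 1)
      - (\<Sum>j=1..d. int_binomial (int (k j) - int n + int i - 1) (int j - 1))"
proof -
  define c where "c j = n + j - 1 - k j" for j
  define w where "w = (\<Sum>j=1..d. var (c j))"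
  note compl = lex_complement_eq_below[OF assms(1-4), folded c_def, folded w_def]
  have T_sub: "T \<subseteq> monomials_in {1..n} d"
    using T by (rule lex_initial_segment_subset)
  have finT: "finite T"
    using T_sub by (rule finite_subset) (simp add: finite_monomials_in)
  define N where "N b = card {u \<in> T. Poly_Mapping.keys u \<subseteq> {..b}}" for b
  have N: "int (N b) = int ((b + d - 1) choose d) - (\<Sum>j=1..d. int ((b + j - 1 - c j) choose j))"
    if "b \<le> n" for b
  proof -
    have "{u \<in> monomials_in {1..n} d - T. Poly_Mapping.keys u \<subseteq> {..b}} =
        {u \<in> monomials_in {..b} d. u < w}"
      unfolding compl(1) using that by (auto simp: monomials_in_def subset_iff)
    then have c1: "card {u \<in> monomials_in {1..n} d - T. Poly_Mapping.keys u \<subseteq> {..b}} =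
        (\<Sum>j=1..d. (b + j - 1 - c j) choose j)"
      using card_monomials_below[OF compl(2)] by (simp add: w_def)
    have "monomials_in {1..b} d = {u \<in> T. Poly_Mapping.keys u \<subseteq> {..b}} \<union>
        {u \<in> monomials_in {1..n} d - T. Poly_Mapping.keys u \<subseteq> {..b}}"
      using T_sub that by (fastforce simp: monomials_in_def)
    then have "card (monomials_in {1..b} d) = N b +
        card {u \<in> monomials_in {1..n} d - T. Poly_Mapping.keys u \<subseteq> {..b}}"
      unfolding N_def using finT by (simp only:, subst card_Un_disjoint) (auto simp: finite_monomials_in)
    then show ?thesis
      unfolding c1 by (simp add: card_monomials_in)
  qed
  have "{u \<in> T. max_index u = i} =
      {u \<in> T. Poly_Mapping.keys u \<subseteq> {..i}} - {u \<in> T. Poly_Mapping.keys u \<subseteq> {..i - 1}}"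
  proof -
    have "u \<noteq> 0" if "u \<in> T" for u
      using that T_sub \<open>d > 0\<close> by (auto simp: monomials_in_def pp_degree_def)
    then have "max_index u = i \<longleftrightarrow> Poly_Mapping.keys u \<subseteq> {..i} \<and> \<not> Poly_Mapping.keys u \<subseteq> {..i - 1}"
      if "u \<in> T" for u
      using that i by (intro max_index_eq_iff) auto
    then show ?thesis by blast
  qed
  moreover have "{u \<in> T. Poly_Mapping.keys u \<subseteq> {..i - 1}} \<subseteq> {u \<in> T. Poly_Mapping.keys u \<subseteq> {..i}}"
    by fastforce
  ultimately have "card {u \<in> T. max_index u = i} = N i - N (i - 1)" "N (i - 1) \<le> N i"
    using finT by (simp_all add: N_def card_Diff_subset card_mono)
  then have "int (card {u \<in> T. max_index u = i}) = int (N i) - int (N (i - 1))" by simp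
  also have "\<dots> = int ((i + d - 1) choose d) - int ((i - 1 + d - 1) choose d)
      - (\<Sum>j=1..d. int ((i + j - 1 - c j) choose j) - int ((i - 1 + j - 1 - c j) choose j))"
  proof -
    have "i \<le> n" "i - 1 \<le> n" using i by auto
    then show ?thesis unfolding sum_subtractf by (simp only: N)
  qed
  also have "int ((i + d - 1) choose d) - int ((i - 1 + d - 1) choose d)
      = int_binomial (int i + int d - 2) (int d - 1)"
  proof -
    obtain i' d' where "i = Suc i'" "d = Suc d'"
      using i \<open>d > 0\<close> by (cases i; cases d) auto
    then show ?thesis by (simp add: int_binomial_def nat_add_distrib)
  qed
  also have "(\<Sum>j=1..d. int ((i + j - 1 - c j) choose j) - int ((i - 1 + j - 1 - c j) choose j)) =
      (\<Sum>j=1..d. int_binomial (int (k j) - int n + int i - 1) (int j - 1))"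
  proof (rule sum.cong)
    fix j assume j: "j \<in> {1..d}"
    then obtain j' where j': "j = Suc j'" by (cases j) auto
    have p: "int (k j) - int n + int i - 1 = int i + int j' - int (c j) - 1"
      using compl(3)[OF j] j' by (simp add: c_def of_nat_diff)
    show "int ((i + j - 1 - c j) choose j) - int ((i - 1 + j - 1 - c j) choose j) =
      int_binomial (int (k j) - int n + int i - 1) (int j - 1)"
    proof (cases "i + j' > c j")
      case True
      then obtain p where p': "i + j' = Suc (c j + p)" by (metis less_imp_Suc_add)
      have e: "i + j - 1 - c j = Suc p" "i - 1 + j - 1 - c j = p"
        using p' j' i by auto
      have "int i + int j' - int (c j) - 1 = int p" using p' by linarith
      then show ?thesis unfolding p e unfolding j' by (simp add: int_binomial_def)
    next
      case False
      then show ?thesis unfolding p unfolding j' using i by (simp add: int_binomial_def)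
    qed
  qed simp
  finally show ?thesis .
qed

section \<open>Monomial ideals as spans of monomials\<close>

text \<open>The monomials of \<open>K[x\<^sub>1,\<dots>,x\<^sub>n]\<close> that are divisible by a monomial from \<open>M\<close>.\<close>

definition multiples :: "nat \<Rightarrow> (nat \<Rightarrow>\<^sub>0 nat) set \<Rightarrow> (nat \<Rightarrow>\<^sub>0 nat) set" where
  "multiples n M = {v + w | v w. v \<in> M \<and> w \<in> power_products n}"

text \<open>The polynomials all of whose monomials lie in \<open>A\<close>.\<close>

definition polys_on :: "(nat \<Rightarrow>\<^sub>0 nat) set \<Rightarrow> 'k::field mpoly set" where
  "polys_on A = {p. Poly_Mapping.keys p \<subseteq> A}"

lemma monomial_of_in_polys_on [simp]: "(monomial_of u :: 'k::field mpoly) \<in> polys_on A \<longleftrightarrow> u \<in> A"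
  by (simp add: monomial_of_def polys_on_def)

lemma polys_on_subset_iff: "(polys_on A :: 'k::field mpoly set) \<subseteq> polys_on B \<longleftrightarrow> A \<subseteq> B"
proof
  assume sub: "(polys_on A :: 'k mpoly set) \<subseteq> polys_on B"
  show "A \<subseteq> B"
  proof
    fix u assume "u \<in> A"
    then have "(monomial_of u :: 'k mpoly) \<in> polys_on A" by simp
    with sub have "(monomial_of u :: 'k mpoly) \<in> polys_on B" by (rule subsetD)
    then show "u \<in> B" by simp
  qed
qed (auto simp: polys_on_def)

lemma polys_on_eq_iff: "(polys_on A :: 'k::field mpoly set) = polys_on B \<longleftrightarrow> A = B"
  using polys_on_subset_iff[of A B] polys_on_subset_iff[of B A] by blast

lemma poly_eq_sum_terms:
  "p = (\<Sum>u\<in>Poly_Mapping.keys p. Poly_Mapping.single u (Poly_Mapping.lookup p u))"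
proof (rule poly_mapping_eqI)
  fix u
  show "Poly_Mapping.lookup p u = Poly_Mapping.lookup
      (\<Sum>v\<in>Poly_Mapping.keys p. Poly_Mapping.single v (Poly_Mapping.lookup p v)) u"
    by (simp add: lookup_sum lookup_single when_def in_keys_iff)
qed

lemma polys_on_minimal:
  fixes V :: "'k::field mpoly set"
  assumes "0 \<in> V" and add: "\<And>p q. p \<in> V \<Longrightarrow> q \<in> V \<Longrightarrow> p + q \<in> V"
    and single: "\<And>u c. u \<in> A \<Longrightarrow> Poly_Mapping.single u c \<in> V"
  shows "polys_on A \<subseteq> V"
proof
  fix p :: "'k mpoly" assume "p \<in> polys_on A"
  then have "Poly_Mapping.keys p \<subseteq> A" by (simp add: polys_on_def)
  have "(\<Sum>u\<in>F. Poly_Mapping.single u (Poly_Mapping.lookup p u)) \<in> V" if "finite F" "F \<subseteq> A" for F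
    using that by (induction F) (simp_all add: assms)
  then show "p \<in> V"
    using \<open>Poly_Mapping.keys p \<subseteq> A\<close> by (subst poly_eq_sum_terms) simp
qed

lemma span_monomials:
  "module.span scalar_mult (monomial_of ` A) = (polys_on A :: 'k::field mpoly set)"
proof -
  interpret vector_space "scalar_mult :: 'k \<Rightarrow> 'k mpoly \<Rightarrow> 'k mpoly"
    by (rule vector_space_scalar_mult)
  have "subspace (polys_on A)"
  proof (rule subspaceI)
    fix p q :: "'k mpoly" and c assume "p \<in> polys_on A" "q \<in> polys_on A"
    then show "p + q \<in> polys_on A"
      using keys_add[of p q] by (auto simp: polys_on_def)
    have "Poly_Mapping.keys (scalar_mult c p) \<subseteq> Poly_Mapping.keys p"
      using keys_mult[of "Poly_Mapping.single 0 c" p] by (auto simp: scalar_mult_def split: if_splits)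
    then show "scalar_mult c p \<in> polys_on A"
      using \<open>p \<in> polys_on A\<close> by (auto simp: polys_on_def)
  qed (simp add: polys_on_def)
  moreover have "polys_on A \<subseteq> span (monomial_of ` A)"
  proof (rule polys_on_minimal)
    fix u and c :: 'k assume "u \<in> A"
    then have "scalar_mult c (monomial_of u) \<in> span (monomial_of ` A)"
      by (intro span_scale span_base) auto
    then show "Poly_Mapping.single u c \<in> span (monomial_of ` A)"
      by (simp add: scalar_mult_def monomial_of_def mult_single)
  qed (auto simp: span_zero span_add)
  ultimately show ?thesis
    by (intro span_subspace) auto
qed

lemma zero_power_products: "0 \<in> power_products n"
  by (simp add: power_products_def)

lemma add_power_products: "u + v \<in> power_products n \<longleftrightarrow> u \<in> power_products n \<and> v \<in> power_products n"
  by (simp add: power_products_def keys_add_nat)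

lemma multiples_subset: "M \<subseteq> power_products n \<Longrightarrow> multiples n M \<subseteq> power_products n"
  by (auto simp: multiples_def add_power_products)

lemma subset_multiples: "M \<subseteq> multiples n M"
proof
  fix u assume "u \<in> M"
  then have "u + 0 \<in> multiples n M"
    unfolding multiples_def using zero_power_products by blast
  then show "u \<in> multiples n M" by simp
qed

lemma ideal_polys_on_multiples:
  assumes "M \<subseteq> power_products n"
  shows "ideal (polys_on (multiples n M)) (poly_ring n :: 'k::field mpoly ring)"
proof -
  interpret cring "poly_ring n :: 'k mpoly ring" by (rule cring_poly_ring)
  let ?I = "polys_on (multiples n M) :: 'k mpoly set"
  have carrier: "?I \<subseteq> carrier (poly_ring n)"
    using multiples_subset[OF assms] by (auto simp: polys_on_def poly_ring_def)
  have mult: "q * p \<in> ?I" if p: "p \<in> ?I" and q: "q \<in> carrier (poly_ring n)" for p q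
  proof -
    have "w \<in> multiples n M" if w: "w \<in> Poly_Mapping.keys (q * p)" for w
    proof -
      obtain b a where "w = b + a" "b \<in> Poly_Mapping.keys q" "a \<in> Poly_Mapping.keys p"
        using w keys_mult[of q p] by blast
      moreover from this p q have "a \<in> multiples n M" "b \<in> power_products n"
        by (auto simp: polys_on_def poly_ring_def)
      moreover from this obtain v v' where "a = v + v'" "v \<in> M" "v' \<in> power_products n"
        by (auto simp: multiples_def)
      ultimately have "w = v + (v' + b)" "v' + b \<in> power_products n"
        by (auto simp: add_power_products ac_simps)
      with \<open>v \<in> M\<close> show ?thesis by (auto simp: multiples_def)
    qed
    then show ?thesis by (auto simp: polys_on_def)
  qed
  have minv: "\<ominus>\<^bsub>poly_ring n\<^esub> p = - p" if "p \<in> carrier (poly_ring n)" for p :: "'k mpoly"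
    using that by (intro minus_equality[symmetric] minus_equality) (auto simp: poly_ring_def)
  show ?thesis
  proof (rule idealI[OF ring_axioms])
    show "subgroup ?I (add_monoid (poly_ring n))"
    proof (rule add.subgroupI)
      show "?I \<noteq> {}" by (auto simp: polys_on_def intro: exI[of _ 0])
      fix p q assume "p \<in> ?I" "q \<in> ?I"
      then show "p \<oplus>\<^bsub>poly_ring n\<^esub> q \<in> ?I"
        using keys_add[of p q] by (auto simp: polys_on_def poly_ring_def)
      show "\<ominus>\<^bsub>poly_ring n\<^esub> p \<in> ?I"
        using \<open>p \<in> ?I\<close> minv[OF subsetD[OF carrier \<open>p \<in> ?I\<close>]] by (simp add: polys_on_def)
    qed (use carrier in simp)
  qed (use mult in \<open>auto simp: poly_ring_def mult.commute\<close>)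
qed

text \<open>
  Stated for all \<open>X\<close> between the generating monomials and the ideal, so that it covers both ideals
  generated by monomials and ideals generated by a homogeneous component.
\<close>

lemma genideal_between:
  assumes M: "M \<subseteq> power_products n" and X: "monomial_of ` M \<subseteq> X" "X \<subseteq> polys_on (multiples n M)"
  shows "Idl\<^bsub>poly_ring n\<^esub> X = (polys_on (multiples n M) :: 'k::field mpoly set)"
proof -
  interpret cring "poly_ring n :: 'k mpoly ring" by (rule cring_poly_ring)
  have "X \<subseteq> carrier (poly_ring n)"
    using X(2) multiples_subset[OF M] by (auto simp: polys_on_def poly_ring_def)
  then have id: "ideal (Idl\<^bsub>poly_ring n\<^esub> X) (poly_ring n)" and sub: "X \<subseteq> Idl\<^bsub>poly_ring n\<^esub> X"
    by (simp_all add: genideal_ideal genideal_self)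
  interpret I: ideal "Idl\<^bsub>poly_ring n\<^esub> X" "poly_ring n" by (rule id)
  have "polys_on (multiples n M) \<subseteq> Idl\<^bsub>poly_ring n\<^esub> X"
  proof (rule polys_on_minimal)
    show "0 \<in> Idl\<^bsub>poly_ring n\<^esub> X"
      using I.zero_closed by (simp add: poly_ring_def)
    show "p + q \<in> Idl\<^bsub>poly_ring n\<^esub> X" if "p \<in> Idl\<^bsub>poly_ring n\<^esub> X" "q \<in> Idl\<^bsub>poly_ring n\<^esub> X" for p q
      using I.a_closed[OF that] by (simp add: poly_ring_def)
    fix u and c :: 'k assume "u \<in> multiples n M"
    then obtain v w where uvw: "u = v + w" "v \<in> M" "w \<in> power_products n"
      by (auto simp: multiples_def)
    have "Poly_Mapping.single w c \<otimes>\<^bsub>poly_ring n\<^esub> monomial_of v \<in> Idl\<^bsub>poly_ring n\<^esub> X"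
      using uvw X(1) sub by (intro I.I_l_closed) (auto simp: poly_ring_def)
    then show "Poly_Mapping.single u c \<in> Idl\<^bsub>poly_ring n\<^esub> X"
      by (simp add: poly_ring_def monomial_of_def mult_single uvw(1) add.commute)
  qed
  moreover have "Idl\<^bsub>poly_ring n\<^esub> X \<subseteq> polys_on (multiples n M)"
    using X(2) by (intro genideal_minimal ideal_polys_on_multiples M)
  ultimately show ?thesis by blast
qed

lemma genideal_monomials:
  assumes "M \<subseteq> power_products n"
  shows "Idl\<^bsub>poly_ring n\<^esub> (monomial_of ` M) = (polys_on (multiples n M) :: 'k::field mpoly set)"
proof (rule genideal_between[OF assms order.refl])
  show "monomial_of ` M \<subseteq> (polys_on (multiples n M) :: 'k mpoly set)"
    using subset_multiples[of M n] by auto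
qed

lemma genideal_polys_on:
  assumes "M \<subseteq> power_products n"
  shows "Idl\<^bsub>poly_ring n\<^esub> (polys_on M) = (polys_on (multiples n M) :: 'k::field mpoly set)"
proof (rule genideal_between[OF assms])
  show "(polys_on M :: 'k mpoly set) \<subseteq> polys_on (multiples n M)"
    by (simp add: polys_on_subset_iff subset_multiples)
qed auto

lemma homogeneous_component_polys_on:
  "homogeneous_component e (polys_on A) = (polys_on {u \<in> A. pp_degree u = e} :: 'k::field mpoly set)"
  by (auto simp: homogeneous_component_def polys_on_def)

lemma multiples_of_own_degree:
  assumes "M \<subseteq> monomials_in {1..n} d"
  shows "{u \<in> multiples n M. pp_degree u = d} = M"
proof
  show "M \<subseteq> {u \<in> multiples n M. pp_degree u = d}"
    using assms subset_multiples[of M n] by (auto simp: monomials_in_def)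
  show "{u \<in> multiples n M. pp_degree u = d} \<subseteq> M"
  proof
    fix u assume "u \<in> {u \<in> multiples n M. pp_degree u = d}"
    then obtain v w where u: "u = v + w" "v \<in> M" "pp_degree u = d"
      by (auto simp: multiples_def)
    then have "pp_degree v = d" using assms by (auto simp: monomials_in_def)
    with u have "w = 0" by (simp add: pp_degree_add pp_degree_zero_iff)
    with u show "u \<in> M" by simp
  qed
qed

text \<open>
  Since all monomials of \<open>T\<close> have degree \<open>d\<close>, none of them is a proper multiple of a monomial in the
  ideal; so every monomial generating set contains \<open>T\<close>.
\<close>

lemma minimal_generators_eq:
  assumes T: "T \<subseteq> monomials_in {1..n} d"
  shows "minimal_monomial_generators n (polys_on (multiples n T) :: 'k::field mpoly set) = T"
proof -
  let ?L = "polys_on (multiples n T) :: 'k mpoly set"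
  have T_pp: "T \<subseteq> power_products n"
    using T by (auto simp: monomials_in_def power_products_def)
  have contains: "T \<subseteq> G"
    if G: "G \<subseteq> power_products n" "?L = Idl\<^bsub>poly_ring n\<^esub> (monomial_of ` G)" for G
  proof
    fix t assume "t \<in> T"
    have eq: "multiples n T = multiples n G"
      using G by (simp add: genideal_monomials polys_on_eq_iff)
    then obtain g w where t: "t = g + w" "g \<in> G"
      using subset_multiples[of T n] \<open>t \<in> T\<close> by (auto simp: multiples_def)
    have "g \<in> multiples n T"
      unfolding eq using subset_multiples t(2) by blast
    then obtain t' w' where g: "g = t' + w'" "t' \<in> T"
      by (auto simp: multiples_def)
    have "pp_degree t = d" "pp_degree t' = d"
      using \<open>t \<in> T\<close> g(2) T by (auto simp: monomials_in_def)
    then have "w = 0"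
      unfolding t(1) g(1) pp_degree_add by (simp add: pp_degree_zero_iff)
    with t show "t \<in> G" by simp
  qed
  have gen: "?L = Idl\<^bsub>poly_ring n\<^esub> (monomial_of ` T)"
    by (simp add: genideal_monomials T_pp)
  show ?thesis
    unfolding minimal_monomial_generators_def
  proof (rule the_equality)
    show "T \<subseteq> power_products n \<and> ?L = Idl\<^bsub>poly_ring n\<^esub> (monomial_of ` T) \<and>
      (\<forall>H. H \<subset> T \<longrightarrow> ?L \<noteq> Idl\<^bsub>poly_ring n\<^esub> (monomial_of ` H))"
      using T_pp gen contains by blast
    show "G = T" if "G \<subseteq> power_products n \<and> ?L = Idl\<^bsub>poly_ring n\<^esub> (monomial_of ` G) \<and>
      (\<forall>H. H \<subset> G \<longrightarrow> ?L \<noteq> Idl\<^bsub>poly_ring n\<^esub> (monomial_of ` H))" for G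
      using that contains[of G] gen by blast
  qed
qed

section \<open>Lexsegment ideals generated in one degree\<close>

lemma lexsegment_ideal_polys_on_iff:
  assumes "M \<subseteq> power_products n"
  shows "lexsegment_ideal n (polys_on (multiples n M) :: 'k::field mpoly set) \<longleftrightarrow>
    (\<forall>e. lex_initial_segment n e {u \<in> multiples n M. pp_degree u = e})"
proof -
  have "monomial_ideal n (polys_on (multiples n M) :: 'k mpoly set)"
    unfolding monomial_ideal_def using assms genideal_monomials by blast
  then show ?thesis
    unfolding lexsegment_ideal_def by (simp add: span_monomials homogeneous_component_polys_on polys_on_eq_iff)
qed

text \<open>
  If \<open>t \<cdot> x\<^sub>j < v\<close> for monomials of equal degree, then \<open>v\<close> divided by its last variable \<open>x\<^sub>b\<close> is still at
  least \<open>t\<close>. Hence, if \<open>t\<close> lies in a lexsegment, \<open>v\<close> is a multiple of a member of that lexsegment.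
\<close>

lemma le_remove_last_variable:
  assumes deg: "pp_degree t = pp_degree v'"
    and less: "t + var j < v' + var b"
    and b: "Poly_Mapping.keys v' \<subseteq> {..b}"
  shows "t \<le> v'"
proof (rule ccontr)
  let ?l = "Poly_Mapping.lookup"
  assume "\<not> t \<le> v'"
  then have "v' < t" by simp
  then obtain a where a: "?l v' a < ?l t a" "\<forall>i<a. ?l v' i = ?l t i"
    by (auto simp: power_product_less_iff)
  obtain i where i: "?l (t + var j) i < ?l (v' + var b) i"
    "\<forall>h<i. ?l (t + var j) h = ?l (v' + var b) h"
    using less by (auto simp: power_product_less_iff)
  have "i \<le> b"
    using i(1) b by (cases "b < i") (auto simp: lookup_add lookup_single in_keys_iff subset_iff)
  have le: "?l t h \<le> ?l v' h" if "h \<le> i" for h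
  proof (cases "h = i")
    case True
    then show ?thesis using i(1) by (simp add: lookup_add lookup_single when_def split: if_splits)
  next
    case False
    then have "?l (t + var j) h = ?l (v' + var b) h" "h \<noteq> b" using i(2) that \<open>i \<le> b\<close> by auto
    then show ?thesis by (simp add: lookup_add lookup_single when_def split: if_splits)
  qed
  then have "i < a" using a(1) by (meson leD not_le)
  \<comment> \<open>\<open>v'\<close> agrees with \<open>t\<close> up to its last variable, and \<open>t\<close> continues: the degrees differ\<close>
  then have "i = b"
    using i(1) a(2) \<open>i \<le> b\<close> by (cases "i = b") (auto simp: lookup_add lookup_single when_def)
  then have "Poly_Mapping.keys v' \<subseteq> {..<a}" using b \<open>i < a\<close> by auto
  then have "pp_degree v' = (\<Sum>h<a. ?l v' h)" by (simp add: pp_degree_superset)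
  also have "\<dots> = (\<Sum>h<a. ?l t h)" using a(2) by simp
  also have "\<dots> < (\<Sum>h<a. ?l t h) + ?l t a" using a(1) by simp
  also have "\<dots> = (\<Sum>h\<in>{..a}. ?l t h)" by (simp add: lessThan_Suc_atMost[symmetric])
  also have "\<dots> \<le> (\<Sum>h\<in>{..a} \<union> Poly_Mapping.keys t. ?l t h)" by (intro sum_mono2) auto
  also have "\<dots> = pp_degree t" by (intro pp_degree_superset[symmetric]) auto
  finally show False using deg by simp
qed

lemma multiples_step:
  assumes T: "T \<subseteq> monomials_in {1..n} d" and "d \<le> e" "u \<in> multiples n T" "pp_degree u = Suc e"
  obtains t j where "u = t + var j" "t \<in> multiples n T" "pp_degree t = e"
proof -
  obtain v w where u: "u = v + w" "v \<in> T" "w \<in> power_products n"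
    using assms(3) by (auto simp: multiples_def)
  have "pp_degree v = d" using u T by (auto simp: monomials_in_def)
  then have "w \<noteq> 0" using assms u by (auto simp: pp_degree_add pp_degree_def)
  then obtain j where "j \<in> Poly_Mapping.keys w"
    by (metis poly_mapping_eqI lookup_zero not_in_keys_iff_lookup_eq_zero)
  then obtain w' where w: "w = var j + w'" by (rule var_factor)
  show ?thesis
  proof
    show "u = (v + w') + var j" by (simp add: u w ac_simps)
    show "v + w' \<in> multiples n T"
      using u w by (auto simp: multiples_def add_power_products)
    show "pp_degree (v + w') = e"
      using assms(4) by (simp add: u w pp_degree_add pp_degree_var)
  qed
qed

text \<open>The multiples of a lexsegment form a lexsegment in each degree.\<close>

lemma lex_initial_segment_multiples:
  assumes T: "lex_initial_segment n d T"
  shows "lex_initial_segment n e {u \<in> multiples n T. pp_degree u = e}"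
proof -
  have T_sub: "T \<subseteq> monomials_in {1..n} d"
    using T by (rule lex_initial_segment_subset)
  then have mult_pp: "multiples n T \<subseteq> power_products n"
    by (intro multiples_subset) (auto simp: monomials_in_def power_products_def)
  show ?thesis
  proof (cases "d \<le> e")
    case True
    then show ?thesis
    proof (induction e rule: dec_induct)
      case base
      show ?case using T by (simp add: multiples_of_own_degree[OF T_sub])
    next
      case (step e)
      show ?case
        unfolding lex_initial_segment_def
      proof (intro conjI ballI impI)
        show "{u \<in> multiples n T. pp_degree u = Suc e} \<subseteq> power_products_of_degree n (Suc e)"
          using mult_pp by (auto simp: power_products_of_degree_def)
      next
        fix u v assume u: "u \<in> {u \<in> multiples n T. pp_degree u = Suc e}"
          and v: "v \<in> power_products_of_degree n (Suc e)" and "u < v"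
        from u obtain t j where t: "u = t + var j" "t \<in> multiples n T" "pp_degree t = e"
          using multiples_step[OF T_sub step(1)] by blast
        define b where "b = max_index v"
        have "Poly_Mapping.keys v \<noteq> {}"
          using v by (auto simp: power_products_of_degree_def pp_degree_def)
        then have b: "b \<in> Poly_Mapping.keys v" "Poly_Mapping.keys v \<subseteq> {..b}"
          by (auto simp: b_def max_index_def)
        then obtain v' where v': "v = var b + v'" using var_factor by blast
        have pp: "v' \<in> power_products n" "var b \<in> power_products n" "pp_degree v' = e"
          using v by (auto simp: v' power_products_of_degree_def add_power_products
              pp_degree_add pp_degree_var)
        have "t \<le> v'"
        proof (rule le_remove_last_variable)
          show "t + var j < v' + var b" using \<open>u < v\<close> t(1) v' by (simp add: add.commute)
        qed (use t pp b in \<open>auto simp: v' keys_add_nat\<close>)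
        then have "v' \<in> multiples n T"
          using step.IH t pp
          by (cases "t = v'") (auto simp: lex_initial_segment_def power_products_of_degree_def)
        then obtain s w where "v' = s + w" "s \<in> T" "w \<in> power_products n"
          by (auto simp: multiples_def)
        then have "v = s + (w + var b)" "w + var b \<in> power_products n"
          using pp by (auto simp: v' add_power_products ac_simps)
        then have "v \<in> multiples n T" using \<open>s \<in> T\<close> by (auto simp: multiples_def)
        then show "v \<in> {u \<in> multiples n T. pp_degree u = Suc e}"
          using v by (simp add: power_products_of_degree_def)
      qed
    qed
  next
    case False
    then have "{u \<in> multiples n T. pp_degree u = e} = {}"
      using T_sub by (auto simp: multiples_def monomials_in_def pp_degree_add)
    then show ?thesis by (simp only: lex_initial_segment_def empty_subsetI ball_empty)
  qed
qed

text \<open>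
  A lexsegment ideal \<open>L\<close> generated in degree \<open>d\<close> is determined by the lexsegment spanning \<open>L\<^sub>d\<close>, which is
  \<open>G(L)\<close>; and every lexsegment of degree \<open>d\<close> arises in this way.
\<close>

lemma d_lex_sequence_iff:
  assumes "d > 0"
  shows "d_lex_sequence TYPE('k::field) n d m \<longleftrightarrow>
    (\<exists>T. lex_initial_segment n d T \<and> (\<forall>i\<in>{1..n}. card {u \<in> T. max_index u = i} = m i))"
proof -
  have sub: "T \<subseteq> monomials_in {1..n} d" "T \<subseteq> power_products n" if "lex_initial_segment n d T" for T
    using lex_initial_segment_subset[OF that] by (auto simp: monomials_in_def power_products_def)
  have count: "generator_count n (polys_on (multiples n T) :: 'k mpoly set) i
      = card {u \<in> T. max_index u = i}" if T: "lex_initial_segment n d T" for T i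
  proof -
    have "u \<noteq> 0" if "u \<in> T" for u
      using sub(1)[OF T] that \<open>d > 0\<close> by (auto simp: monomials_in_def pp_degree_def)
    then show ?thesis
      unfolding generator_count_def minimal_generators_eq[OF sub(1)[OF T]]
      by (intro arg_cong[of _ _ card]) auto
  qed
  show ?thesis
  proof
    assume "d_lex_sequence TYPE('k) n d m"
    then obtain L :: "'k mpoly set" where L: "lexsegment_ideal n L" "generated_in_degree n d L"
      and m: "\<forall>i\<in>{1..n}. generator_count n L i = m i"
      by (auto simp: d_lex_sequence_def)
    obtain T where T: "lex_initial_segment n d T" "homogeneous_component d L = polys_on T"
      using L(1) by (auto simp: lexsegment_ideal_def span_monomials)
    then have "L = polys_on (multiples n T)"
      using L(2) sub(2) by (simp add: generated_in_degree_def genideal_polys_on)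
    then show "\<exists>T. lex_initial_segment n d T \<and> (\<forall>i\<in>{1..n}. card {u \<in> T. max_index u = i} = m i)"
      using T(1) m count by auto
  next
    assume "\<exists>T. lex_initial_segment n d T \<and> (\<forall>i\<in>{1..n}. card {u \<in> T. max_index u = i} = m i)"
    then obtain T where T: "lex_initial_segment n d T"
      and m: "\<forall>i\<in>{1..n}. card {u \<in> T. max_index u = i} = m i" by blast
    let ?L = "polys_on (multiples n T) :: 'k mpoly set"
    have "lexsegment_ideal n ?L"
      using T sub(2) lex_initial_segment_multiples by (simp add: lexsegment_ideal_polys_on_iff)
    moreover have "generated_in_degree n d ?L"
      using T sub by (simp add: generated_in_degree_def homogeneous_component_polys_on
          multiples_of_own_degree genideal_polys_on)
    ultimately show "d_lex_sequence TYPE('k) n d m"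
      unfolding d_lex_sequence_def using m count[OF T] by auto
  qed
qed

theorem proposition2p13:
  fixes n d \<mu> l :: nat and m k :: "nat \<Rightarrow> nat"
  assumes "d > 0"
    and "\<mu> = (\<Sum>i=1..n. m i)"
    and "int_binomial (int n + int d - 1) (int d) - int \<mu> \<ge> 0"
    and "int l = int_binomial (int n + int d - 1) (int d) - int \<mu>"
    and "macaulay_representation d l k"
  shows "d_lex_sequence TYPE('k::field) n d m \<longleftrightarrow>
    (\<forall>i\<in>{1..n}. int (m i) =
      int_binomial (int i + int d - 2) (int d - 1)
      - (\<Sum>j=1..d. int_binomial (int (k j) - int n + int i - 1) (int j - 1)))"
    (is "_ \<longleftrightarrow> (\<forall>i\<in>{1..n}. int (m i) = ?f i)")
proof -
  let ?S = "monomials_in {1..n} d"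
  have eq: "int n + int d - 1 = int (n + d - 1)" using \<open>d > 0\<close> by linarith
  have "int_binomial (int n + int d - 1) (int d) = int (card ?S)"
    unfolding eq by (simp add: int_binomial_def card_monomials_in)
  with assms(4) have S: "int (card ?S) = int \<mu> + int l" by linarith
  have formula: "int (card {u \<in> T. max_index u = i}) = ?f i"
    if T: "lex_initial_segment n d T" "card T = \<mu>" and i: "i \<in> {1..n}" for T i
  proof -
    have "T \<subseteq> ?S"
      using T(1) by (rule lex_initial_segment_subset)
    then have "card (?S - T) = l"
      using S T(2) finite_subset[OF _ finite_monomials_in[of "{1..n}" d]] by (simp add: card_Diff_subset)
    then show ?thesis
      using \<open>d > 0\<close> T(1) i assms(5) by (intro card_max_index_lex_segment)
  qed
  show ?thesis
    unfolding d_lex_sequence_iff[OF \<open>d > 0\<close>]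
  proof
    assume "\<exists>T. lex_initial_segment n d T \<and> (\<forall>i\<in>{1..n}. card {u \<in> T. max_index u = i} = m i)"
    then obtain T where T: "lex_initial_segment n d T"
      and m: "\<forall>i\<in>{1..n}. card {u \<in> T. max_index u = i} = m i" by blast
    have T_sub: "T \<subseteq> ?S"
      using T by (rule lex_initial_segment_subset)
    then have fin: "finite T" by (rule finite_subset) (simp add: finite_monomials_in)
    have "max_index u \<in> {1..n}" if "u \<in> T" for u
    proof -
      have "Poly_Mapping.keys u \<noteq> {}" "Poly_Mapping.keys u \<subseteq> {1..n}"
        using that T_sub \<open>d > 0\<close> by (auto simp: monomials_in_def pp_degree_def)
      then show ?thesis
        unfolding max_index_def using Max_in[OF finite_keys] by blast
    qed
    then have "card T = (\<Sum>i\<in>{1..n}. card {u \<in> T. max_index u = i})"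
      using fin sum.group[of T "{1..n}" max_index "\<lambda>_. 1::nat"] by (simp add: image_subset_iff)
    then have "card T = \<mu>" using m assms(2) by simp
    then show "\<forall>i\<in>{1..n}. int (m i) = ?f i"
      using formula[OF T] m by auto
  next
    assume f: "\<forall>i\<in>{1..n}. int (m i) = ?f i"
    have "\<mu> \<le> card ?S" using S by linarith
    then obtain T where T: "T \<subseteq> ?S" "card T = \<mu>"
      "\<And>u v. u \<in> T \<Longrightarrow> v \<in> ?S \<Longrightarrow> u < v \<Longrightarrow> v \<in> T"
      using ex_upper_subset_card[of ?S \<mu>] finite_monomials_in[of "{1..n}" d] by blast
    then have lex: "lex_initial_segment n d T"
      unfolding lex_initial_segment_def power_products_of_degree_eq by blast
    have "card {u \<in> T. max_index u = i} = m i" if "i \<in> {1..n}" for i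
      using formula[OF lex T(2) that] bspec[OF f that] by linarith
    with lex show "\<exists>T. lex_initial_segment n d T \<and> (\<forall>i\<in>{1..n}. card {u \<in> T. max_index u = i} = m i)"
      by blast
  qed
qed

end
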